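(* Let $\mathbb{E}: K\xrightarrow{k}X\xrightarrow{f}M$ be a Schreier extension of monoids with $K$ commutative and cancellative, and let $R_{\mathbb{E}}=\{(x,z)\in X\times X: z=k(a)+x\text{ for some }a\in K\}$, seen as an internal reflexive relation $\mathcal{R}_{\mathbb{E}}$ on $X$ in the category of monoids. Then $\mathcal{R}_{\mathbb{E}}$ centralises itself: there exists a monoid homomorphism $p\colon R_{\mathbb{E}}\times_X R_{\mathbb{E}}\to X$, where $R_{\mathbb{E}}\times_X R_{\mathbb{E}}=\{(x,y,z): (x,y)\in R_{\mathbb{E}},\ (y,z)\in R_{\mathbb{E}}\}$, such that $p(x,x,z)=z$ for all $(x,z)\in R_{\mathbb{E}}$ and $p(x,y,y)=x$ for all $(x,y)\in R_{\mathbb{E}}$.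
   Context: Monoids $K,X$ are written additively ($X$ is not assumed commutative) and $M$ multiplicatively with unit $1$. A monoid extension $K\xrightarrow{k}X\xrightarrow{f}M$ consists of a surjective monoid homomorphism $f$ and a kernel $(K,k)$ of $f$ (so $k$ is injective with image $\{x: f(x)=1\}$). It is a Schreier extension if for every $m\in M$ there is $u\in f^{-1}(m)$ such that for every $x\in f^{-1}(m)$ there is a unique $a\in K$ with $x=k(a)+u$. $R_{\mathbb{E}}$ is a submonoid of $X\times X$ containing the diagonal, and $\mathcal{R}_{\mathbb{E}}$ is a Schreier reflexive relation, meaning that the first projection $R_{\mathbb{E}}\to X$ split by the diagonal is a Schreier point; for a reflexive relation and a Schreier reflexive relation, centralising each other means the existence of a homomorphism (connector) as described in the claim, which is then necessarily unique. *)

theory Defs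
  imports "HOL-Algebra.Divisibility"
begin

text \<open>
  All monoids are structures of \<^theory>\<open>HOL-Algebra.Group\<close>, hence written multiplicatively:
  \<open>k a \<otimes> x\<close> below stands for $k(a) + x$ and \<open>\<one>\<close> for the neutral element.
\<close>

text \<open>The library's \<^const>\<open>hom\<close> does not demand preservation of the unit.\<close>

definition monoid_hom :: "('a, 'c) monoid_scheme \<Rightarrow> ('b, 'd) monoid_scheme \<Rightarrow> ('a \<Rightarrow> 'b) set"
  where "monoid_hom G H = {h \<in> hom G H. h \<one>\<^bsub>G\<^esub> = \<one>\<^bsub>H\<^esub>}"

locale monoid_extension = K: monoid K + X: monoid X + M: monoid M
  for K :: "('k, 'c) monoid_scheme" and X :: "('x, 'd) monoid_scheme"
    and M :: "('m, 'e) monoid_scheme" +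
  fixes k :: "'k \<Rightarrow> 'x" and f :: "'x \<Rightarrow> 'm"
  assumes k_hom: "k \<in> monoid_hom K X"
    and f_hom: "f \<in> monoid_hom X M"
    and f_surj: "f ` carrier X = carrier M"
    and k_inj: "inj_on k (carrier K)"
    and k_image: "k ` carrier K = kernel X M f"

locale schreier_extension = monoid_extension +
  assumes schreier:
    "\<forall>m \<in> carrier M. \<exists>u \<in> carrier X. f u = m \<and>
       (\<forall>x \<in> carrier X. f x = m \<longrightarrow> (\<exists>!a. a \<in> carrier K \<and> x = k a \<otimes>\<^bsub>X\<^esub> u))"

definition extension_relation ::
    "('k, 'c) monoid_scheme \<Rightarrow> ('x, 'd) monoid_scheme \<Rightarrow> ('k \<Rightarrow> 'x) \<Rightarrow> ('x \<times> 'x) set"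
  where "extension_relation K X k =
    {(x, z). x \<in> carrier X \<and> z \<in> carrier X \<and> (\<exists>a \<in> carrier K. z = k a \<otimes>\<^bsub>X\<^esub> x)}"

definition reflexive_relation :: "('x, 'd) monoid_scheme \<Rightarrow> ('x \<times> 'x) set \<Rightarrow> bool"
  where "reflexive_relation X R \<longleftrightarrow> submonoid R (X \<times>\<times> X) \<and> (\<forall>x \<in> carrier X. (x, x) \<in> R)"

definition relation_monoid :: "('x, 'd) monoid_scheme \<Rightarrow> ('x \<times> 'x) set \<Rightarrow> ('x \<times> 'x) monoid"
  where "relation_monoid X R = (X \<times>\<times> X)\<lparr>carrier := R\<rparr>"

text \<open>A Schreier point: a split epimorphism \<open>g\<close> with section \<open>s\<close> such that every \<open>x\<close> is
  \<open>a \<otimes> s (g x)\<close> for a unique \<open>a\<close> in the kernel of \<open>g\<close>.\<close>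

definition schreier_point ::
    "('a, 'c) monoid_scheme \<Rightarrow> ('b, 'd) monoid_scheme \<Rightarrow> ('a \<Rightarrow> 'b) \<Rightarrow> ('b \<Rightarrow> 'a) \<Rightarrow> bool"
  where "schreier_point A B g s \<longleftrightarrow>
    monoid A \<and> monoid B \<and> g \<in> monoid_hom A B \<and> s \<in> monoid_hom B A \<and>
    (\<forall>b \<in> carrier B. g (s b) = b) \<and>
    (\<forall>x \<in> carrier A. \<exists>!a. a \<in> kernel A B g \<and> x = a \<otimes>\<^bsub>A\<^esub> s (g x))"

definition schreier_reflexive_relation :: "('x, 'd) monoid_scheme \<Rightarrow> ('x \<times> 'x) set \<Rightarrow> bool"
  where "schreier_reflexive_relation X S \<longleftrightarrow>
    reflexive_relation X S \<and> schreier_point (relation_monoid X S) X fst (\<lambda>x. (x, x))"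

text \<open>The pullback of the second projection of \<open>R\<close> along the first projection of \<open>S\<close>, as a
  submonoid of the threefold product.\<close>

definition relation_pullback ::
    "('x, 'd) monoid_scheme \<Rightarrow> ('x \<times> 'x) set \<Rightarrow> ('x \<times> 'x) set \<Rightarrow> ('x \<times> 'x \<times> 'x) monoid"
  where "relation_pullback X R S =
    (X \<times>\<times> X \<times>\<times> X)\<lparr>carrier := {(x, y, z). (x, y) \<in> R \<and> (y, z) \<in> S}\<rparr>"

definition connector ::
    "('x, 'd) monoid_scheme \<Rightarrow> ('x \<times> 'x) set \<Rightarrow> ('x \<times> 'x) set \<Rightarrow> ('x \<times> 'x \<times> 'x \<Rightarrow> 'x) \<Rightarrow> bool"
  where "connector X R S p \<longleftrightarrow>
    p \<in> monoid_hom (relation_pullback X R S) X \<and>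
    (\<forall>x z. (x, z) \<in> S \<longrightarrow> p (x, x, z) = z) \<and>
    (\<forall>x y. (x, y) \<in> R \<longrightarrow> p (x, y, y) = x)"

text \<open>Centralising is only a notion for a reflexive relation \<open>R\<close> and a Schreier reflexive
  relation \<open>S\<close>, so these conditions are part of the predicate.\<close>

definition centralises :: "('x, 'd) monoid_scheme \<Rightarrow> ('x \<times> 'x) set \<Rightarrow> ('x \<times> 'x) set \<Rightarrow> bool"
  where "centralises X R S \<longleftrightarrow>
    reflexive_relation X R \<and> schreier_reflexive_relation X S \<and> (\<exists>p. connector X R S p)"

end

theory Submission
  imports Defs
begin

text \<open>
  Commutativity of \<open>K\<close> lets every element of a fibre of \<open>f\<close> conjugate \<open>K\<close> in the same way:
  writing \<open>x = k b \<otimes> u\<close> with \<open>u\<close> the Schreier representative of \<open>f x\<close> and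
  \<open>u \<otimes> k a = k c \<otimes> u\<close>, one gets \<open>x \<otimes> k a = k c \<otimes> x\<close> with \<open>c\<close> depending only on \<open>f x\<close> and
  \<open>a\<close>. Cancellativity of \<open>K\<close> makes \<open>b\<close> in \<open>z = k b \<otimes> y\<close> unique, and the connector is
  \<open>p (x, y, z) = k b \<otimes> x\<close>. It is multiplicative because \<open>f x = f y\<close> for related \<open>x\<close> and \<open>y\<close>,
  so that \<open>b'\<close> is moved past \<open>x\<close> and past \<open>y\<close> by the same conjugation.
\<close>

section \<open>Homomorphism rules for the extension\<close>

context monoid_extension
begin

lemma k_closed [simp]: "a \<in> carrier K \<Longrightarrow> k a \<in> carrier X"
  using k_hom by (auto simp: monoid_hom_def hom_def)

lemma k_mult [simp]:
  "a \<in> carrier K \<Longrightarrow> b \<in> carrier K \<Longrightarrow> k (a \<otimes>\<^bsub>K\<^esub> b) = k a \<otimes>\<^bsub>X\<^esub> k b"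
  using k_hom by (auto simp: monoid_hom_def hom_def)

lemma k_one [simp]: "k \<one>\<^bsub>K\<^esub> = \<one>\<^bsub>X\<^esub>"
  using k_hom by (auto simp: monoid_hom_def)

lemma f_closed [simp]: "x \<in> carrier X \<Longrightarrow> f x \<in> carrier M"
  using f_hom by (auto simp: monoid_hom_def hom_def)

lemma f_mult [simp]:
  "x \<in> carrier X \<Longrightarrow> y \<in> carrier X \<Longrightarrow> f (x \<otimes>\<^bsub>X\<^esub> y) = f x \<otimes>\<^bsub>M\<^esub> f y"
  using f_hom by (auto simp: monoid_hom_def hom_def)

lemma f_k [simp]: "a \<in> carrier K \<Longrightarrow> f (k a) = \<one>\<^bsub>M\<^esub>"
  using k_image by (auto simp: kernel_def)

end

section \<open>Schreier representatives, the action of the kernel and conjugation\<close>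

locale comm_schreier_extension =
  schreier_extension K X M k f + K: comm_monoid_cancel K
  for K :: "('k, 'c) monoid_scheme" and X :: "('x, 'd) monoid_scheme"
    and M :: "('m, 'e) monoid_scheme" and k :: "'k \<Rightarrow> 'x" and f :: "'x \<Rightarrow> 'm"
begin

abbreviation "R \<equiv> extension_relation K X k"

text \<open>Splits the unique existence in \<open>schreier\<close> into a covering property and a
  freeness property of \<open>u\<close>, since later arguments use them separately.\<close>

lemma schreier_representative:
  assumes "m \<in> carrier M"
  obtains u where "u \<in> carrier X" "f u = m"
    "\<And>x. x \<in> carrier X \<Longrightarrow> f x = m \<Longrightarrow> \<exists>a \<in> carrier K. x = k a \<otimes>\<^bsub>X\<^esub> u"
    "\<And>a b. a \<in> carrier K \<Longrightarrow> b \<in> carrier K \<Longrightarrow> k a \<otimes>\<^bsub>X\<^esub> u = k b \<otimes>\<^bsub>X\<^esub> u \<Longrightarrow> a = b"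
proof -
  obtain u where u: "u \<in> carrier X" "f u = m"
    and ex1: "\<And>x. x \<in> carrier X \<Longrightarrow> f x = m \<Longrightarrow> \<exists>!a. a \<in> carrier K \<and> x = k a \<otimes>\<^bsub>X\<^esub> u"
    using bspec[OF schreier assms] by (elim bexE conjE) simp
  show thesis
  proof (rule that[OF u])
    show "\<exists>a \<in> carrier K. x = k a \<otimes>\<^bsub>X\<^esub> u" if "x \<in> carrier X" "f x = m" for x
      using ex1[OF that] by blast
    show "a = b" if "a \<in> carrier K" "b \<in> carrier K" "k a \<otimes>\<^bsub>X\<^esub> u = k b \<otimes>\<^bsub>X\<^esub> u" for a b
    proof -
      \<comment> \<open>\<open>k a\<close> lies in the kernel of \<open>f\<close>, so
        \<open>k a \<otimes> u\<close> stays in the fibre of \<open>u\<close> and the uniqueness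
        clause applies to it.\<close>
      have "\<exists>!c. c \<in> carrier K \<and> k a \<otimes>\<^bsub>X\<^esub> u = k c \<otimes>\<^bsub>X\<^esub> u"
        by (rule ex1) (use that u assms in simp_all)
      then show ?thesis
        using that by (elim ex1E) metis
    qed
  qed
qed

text \<open>The Schreier condition gives freeness only at the representative \<open>u\<close>.
  Writing \<open>x = k c \<otimes> u\<close> carries the equation over to \<open>u\<close>, and
  cancelling \<open>c\<close> in \<open>K\<close> gives the claim at every \<open>x\<close>.\<close>

lemma k_action_cancel:
  assumes "a \<in> carrier K" "b \<in> carrier K" "x \<in> carrier X"
    and "k a \<otimes>\<^bsub>X\<^esub> x = k b \<otimes>\<^bsub>X\<^esub> x"
  shows "a = b"
proof -
  obtain u where u: "u \<in> carrier X"
    and ex: "\<And>x'. x' \<in> carrier X \<Longrightarrow> f x' = f x \<Longrightarrow> \<exists>c \<in> carrier K. x' = k c \<otimes>\<^bsub>X\<^esub> u"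
    and inj: "\<And>a b. a \<in> carrier K \<Longrightarrow> b \<in> carrier K \<Longrightarrow> k a \<otimes>\<^bsub>X\<^esub> u = k b \<otimes>\<^bsub>X\<^esub> u \<Longrightarrow> a = b"
    using schreier_representative[of "f x"] assms(3) f_closed by metis
  obtain c where c: "c \<in> carrier K" "x = k c \<otimes>\<^bsub>X\<^esub> u"
    using ex assms(3) by blast
  have "k (a \<otimes>\<^bsub>K\<^esub> c) \<otimes>\<^bsub>X\<^esub> u = k (b \<otimes>\<^bsub>K\<^esub> c) \<otimes>\<^bsub>X\<^esub> u"
    using assms c u by (simp add: X.m_assoc)
  then have "a \<otimes>\<^bsub>K\<^esub> c = b \<otimes>\<^bsub>K\<^esub> c"
    using inj assms c by blast
  then show ?thesis
    using K.r_cancel assms c by blast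
qed

lemma uniform_conjugation:
  assumes "m \<in> carrier M" "a \<in> carrier K"
  obtains c where "c \<in> carrier K"
    "\<And>x. x \<in> carrier X \<Longrightarrow> f x = m \<Longrightarrow> x \<otimes>\<^bsub>X\<^esub> k a = k c \<otimes>\<^bsub>X\<^esub> x"
proof -
  obtain u where u: "u \<in> carrier X" "f u = m"
    and ex: "\<And>x. x \<in> carrier X \<Longrightarrow> f x = m \<Longrightarrow> \<exists>c \<in> carrier K. x = k c \<otimes>\<^bsub>X\<^esub> u"
    using schreier_representative[OF assms(1)] by metis
  \<comment> \<open>Multiplying by \<open>k a\<close> on the right also preserves the fibre, so
    \<open>u\<close> can be split off on the right again; its coefficient is
    \<open>c\<close>.\<close>
  have "f (u \<otimes>\<^bsub>X\<^esub> k a) = m"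
    using u assms by simp
  then obtain c where c: "c \<in> carrier K" "u \<otimes>\<^bsub>X\<^esub> k a = k c \<otimes>\<^bsub>X\<^esub> u"
    using ex u assms k_closed X.m_closed by metis
  show thesis
  proof (rule that[OF c(1)])
    fix x assume x: "x \<in> carrier X" "f x = m"
    then obtain b where b: "b \<in> carrier K" "x = k b \<otimes>\<^bsub>X\<^esub> u"
      using ex by blast
    have "x \<otimes>\<^bsub>X\<^esub> k a = k (b \<otimes>\<^bsub>K\<^esub> c) \<otimes>\<^bsub>X\<^esub> u"
      using b c u assms by (simp add: X.m_assoc)
    \<comment> \<open>Commutativity of \<open>K\<close> makes the position \<open>b\<close> of
      \<open>x\<close> in its fibre irrelevant: the \<open>c\<close> found for \<open>u\<close>
      serves \<open>x\<close> too.\<close>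
    also have "\<dots> = k (c \<otimes>\<^bsub>K\<^esub> b) \<otimes>\<^bsub>X\<^esub> u"
      using b c by (simp only: K.m_comm)
    also have "\<dots> = k c \<otimes>\<^bsub>X\<^esub> x"
      using b c u by (simp add: X.m_assoc)
    finally show "x \<otimes>\<^bsub>X\<^esub> k a = k c \<otimes>\<^bsub>X\<^esub> x" .
  qed
qed

section \<open>The extension relation as a Schreier reflexive relation\<close>

lemma extension_relationE:
  assumes "(x, z) \<in> R"
  obtains a where "a \<in> carrier K" "x \<in> carrier X" "z \<in> carrier X" "z = k a \<otimes>\<^bsub>X\<^esub> x"
  using assms by (auto simp: extension_relation_def)

lemma extension_relationI:
  "a \<in> carrier K \<Longrightarrow> x \<in> carrier X \<Longrightarrow> (x, k a \<otimes>\<^bsub>X\<^esub> x) \<in> R"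
  by (auto simp: extension_relation_def)

lemma extension_relation_carrier:
  assumes "(x, z) \<in> R"
  shows "x \<in> carrier X" "z \<in> carrier X"
  using assms by (simp_all add: extension_relation_def)

lemma extension_relation_refl: "x \<in> carrier X \<Longrightarrow> (x, x) \<in> R"
  using extension_relationI[of "\<one>\<^bsub>K\<^esub>" x] by simp

lemma extension_relation_fibre: "(x, z) \<in> R \<Longrightarrow> f z = f x"
  by (erule extension_relationE) simp

text \<open>Moving \<open>k b\<close> left past \<open>x\<close> changes it to some
  \<open>k d\<close> that depends only on the fibre of \<open>x\<close>, so \<open>c\<close> is
  \<open>a \<otimes> d\<close>. That one \<open>c\<close> serves all \<open>x\<close> and
  \<open>x'\<close> at once is what makes the connector multiplicative.\<close>

lemma product_conjugation:
  assumes "m \<in> carrier M" "a \<in> carrier K" "b \<in> carrier K"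
  obtains c where "c \<in> carrier K"
    "\<And>x x'. x \<in> carrier X \<Longrightarrow> x' \<in> carrier X \<Longrightarrow> f x = m \<Longrightarrow>
      (k a \<otimes>\<^bsub>X\<^esub> x) \<otimes>\<^bsub>X\<^esub> (k b \<otimes>\<^bsub>X\<^esub> x') = k c \<otimes>\<^bsub>X\<^esub> (x \<otimes>\<^bsub>X\<^esub> x')"
proof -
  obtain d where d: "d \<in> carrier K"
    "\<And>x. x \<in> carrier X \<Longrightarrow> f x = m \<Longrightarrow> x \<otimes>\<^bsub>X\<^esub> k b = k d \<otimes>\<^bsub>X\<^esub> x"
    using uniform_conjugation[OF assms(1,3)] by metis
  show thesis
  proof (rule that)
    show "a \<otimes>\<^bsub>K\<^esub> d \<in> carrier K" using assms d by simp
    fix x x' assume x: "x \<in> carrier X" "x' \<in> carrier X" "f x = m"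
    have "(k a \<otimes>\<^bsub>X\<^esub> x) \<otimes>\<^bsub>X\<^esub> (k b \<otimes>\<^bsub>X\<^esub> x') = k a \<otimes>\<^bsub>X\<^esub> ((x \<otimes>\<^bsub>X\<^esub> k b) \<otimes>\<^bsub>X\<^esub> x')"
      using x assms by (simp add: X.m_assoc)
    also have "\<dots> = k (a \<otimes>\<^bsub>K\<^esub> d) \<otimes>\<^bsub>X\<^esub> (x \<otimes>\<^bsub>X\<^esub> x')"
      using x assms d by (simp add: X.m_assoc)
    finally show "(k a \<otimes>\<^bsub>X\<^esub> x) \<otimes>\<^bsub>X\<^esub> (k b \<otimes>\<^bsub>X\<^esub> x') = k (a \<otimes>\<^bsub>K\<^esub> d) \<otimes>\<^bsub>X\<^esub> (x \<otimes>\<^bsub>X\<^esub> x')" .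
  qed
qed

lemma extension_relation_mult:
  assumes "(x, z) \<in> R" "(x', z') \<in> R"
  shows "(x \<otimes>\<^bsub>X\<^esub> x', z \<otimes>\<^bsub>X\<^esub> z') \<in> R"
proof -
  obtain a where a: "a \<in> carrier K" "x \<in> carrier X" "z = k a \<otimes>\<^bsub>X\<^esub> x"
    using assms(1) by (rule extension_relationE)
  obtain b where b: "b \<in> carrier K" "x' \<in> carrier X" "z' = k b \<otimes>\<^bsub>X\<^esub> x'"
    using assms(2) by (rule extension_relationE)
  obtain c where "c \<in> carrier K" "z \<otimes>\<^bsub>X\<^esub> z' = k c \<otimes>\<^bsub>X\<^esub> (x \<otimes>\<^bsub>X\<^esub> x')"
    using product_conjugation[of "f x" a b] a b f_closed by metis
  then show ?thesis
    using a b extension_relationI by simp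
qed

lemma reflexive_extension_relation: "reflexive_relation X R"
  unfolding reflexive_relation_def
proof (intro conjI ballI)
  show "submonoid R (X \<times>\<times> X)"
  proof
    show "R \<subseteq> carrier (X \<times>\<times> X)"
      by (auto simp: extension_relation_def)
    show "v \<otimes>\<^bsub>X \<times>\<times> X\<^esub> w \<in> R" if "v \<in> R" "w \<in> R" for v w
      using that by (cases v; cases w) (simp add: extension_relation_mult)
    show "\<one>\<^bsub>X \<times>\<times> X\<^esub> \<in> R"
      by (simp add: DirProd_def extension_relation_refl)
  qed
qed (rule extension_relation_refl)

lemma schreier_reflexive_extension_relation: "schreier_reflexive_relation X R"
proof -
  let ?A = "relation_monoid X R"
  interpret XX: monoid "X \<times>\<times> X"
    by (rule DirProd_monoid[OF X.monoid_axioms X.monoid_axioms])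
  have "monoid ?A"
    unfolding relation_monoid_def
    using submonoid.submonoid_is_monoid[OF _ XX.monoid_axioms] reflexive_extension_relation
    by (auto simp: reflexive_relation_def)
  moreover have "fst \<in> monoid_hom ?A X"
    by (auto simp: monoid_hom_def hom_def relation_monoid_def DirProd_def extension_relation_def)
  moreover have "(\<lambda>x. (x, x)) \<in> monoid_hom X ?A"
    by (auto simp: monoid_hom_def hom_def relation_monoid_def DirProd_def extension_relation_refl)
  moreover have "\<exists>!v. v \<in> kernel ?A X fst \<and> w = v \<otimes>\<^bsub>?A\<^esub> (fst w, fst w)"
    if "w \<in> carrier ?A" for w
  proof -
    have "(fst w, snd w) \<in> R"
      using that by (simp add: relation_monoid_def)
    then obtain a where a: "a \<in> carrier K" "fst w \<in> carrier X" "snd w = k a \<otimes>\<^bsub>X\<^esub> fst w"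
      by (rule extension_relationE)
    show ?thesis
    \<comment> \<open>The kernel of the first projection consists of the pairs with first entry the
      unit and second entry in the image of \<open>k\<close>; the coefficient \<open>a\<close>
      relating the entries of \<open>w\<close> therefore gives the kernel part.\<close>
    proof (rule ex1I[of _ "(\<one>\<^bsub>X\<^esub>, k a)"])
      show "(\<one>\<^bsub>X\<^esub>, k a) \<in> kernel ?A X fst \<and> w = (\<one>\<^bsub>X\<^esub>, k a) \<otimes>\<^bsub>?A\<^esub> (fst w, fst w)"
        using a extension_relationI[of a "\<one>\<^bsub>X\<^esub>"]
        by (simp add: kernel_def relation_monoid_def DirProd_def prod_eq_iff)
      fix v assume v: "v \<in> kernel ?A X fst \<and> w = v \<otimes>\<^bsub>?A\<^esub> (fst w, fst w)"
      then have fst: "fst v = \<one>\<^bsub>X\<^esub>" and "v \<in> R"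
        by (simp_all add: kernel_def relation_monoid_def)
      then have "(\<one>\<^bsub>X\<^esub>, snd v) \<in> R"
        by (metis prod.collapse)
      then obtain b where b: "b \<in> carrier K" "snd v = k b"
        by (auto elim!: extension_relationE)
      \<comment> \<open>Second components turn uniqueness of the kernel part into freeness of the
        action of \<open>K\<close> on \<open>X\<close>.\<close>
      have "snd w = snd (v \<otimes>\<^bsub>?A\<^esub> (fst w, fst w))"
        using v by (rule arg_cong[OF conjunct2])
      also have "\<dots> = snd v \<otimes>\<^bsub>X\<^esub> fst w"
        by (simp add: relation_monoid_def DirProd_def case_prod_beta)
      finally have "k b \<otimes>\<^bsub>X\<^esub> fst w = k a \<otimes>\<^bsub>X\<^esub> fst w"
        using a(3) b(2) by simp
      then have "b = a"
        using a b k_action_cancel by blast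
      then show "v = (\<one>\<^bsub>X\<^esub>, k a)"
        using fst b by (simp add: prod_eq_iff)
    qed
  qed
  ultimately show ?thesis
    unfolding schreier_reflexive_relation_def schreier_point_def
    using reflexive_extension_relation X.monoid_axioms by simp
qed

section \<open>The connector, which for a group \<open>X\<close> is the Mal'tsev operation z y^-1
  x\<close>

definition extension_connector :: "'x \<times> 'x \<times> 'x \<Rightarrow> 'x"
  where "extension_connector =
    (\<lambda>(x, y, z). k (THE b. b \<in> carrier K \<and> z = k b \<otimes>\<^bsub>X\<^esub> y) \<otimes>\<^bsub>X\<^esub> x)"

text \<open>By \<open>k_action_cancel\<close> any known coefficient from \<open>y\<close> to
  \<open>z\<close> is the one picked by the description operator.\<close>

lemma extension_connector_eq:
  assumes "b \<in> carrier K" "y \<in> carrier X" "z = k b \<otimes>\<^bsub>X\<^esub> y"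
  shows "extension_connector (x, y, z) = k b \<otimes>\<^bsub>X\<^esub> x"
proof -
  have "(THE b. b \<in> carrier K \<and> z = k b \<otimes>\<^bsub>X\<^esub> y) = b"
    using assms k_action_cancel by (intro the_equality) auto
  then show ?thesis
    by (simp add: extension_connector_def)
qed

lemma extension_connector_closed:
  assumes "(x, y) \<in> R" "(y, z) \<in> R"
  shows "extension_connector (x, y, z) \<in> carrier X"
proof -
  obtain b where b: "b \<in> carrier K" "y \<in> carrier X" "z = k b \<otimes>\<^bsub>X\<^esub> y"
    using assms(2) by (rule extension_relationE)
  then show ?thesis
    using extension_relation_carrier[OF assms(1)] extension_connector_eq[OF b] by simp
qed

lemma extension_connector_mult:
  assumes "(x, y) \<in> R" "(y, z) \<in> R" "(x', y') \<in> R" "(y', z') \<in> R"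
  shows "extension_connector (x \<otimes>\<^bsub>X\<^esub> x', y \<otimes>\<^bsub>X\<^esub> y', z \<otimes>\<^bsub>X\<^esub> z') =
    extension_connector (x, y, z) \<otimes>\<^bsub>X\<^esub> extension_connector (x', y', z')"
proof -
  obtain b where b: "b \<in> carrier K" "y \<in> carrier X" "z = k b \<otimes>\<^bsub>X\<^esub> y"
    using assms(2) by (rule extension_relationE)
  obtain b' where b': "b' \<in> carrier K" "y' \<in> carrier X" "z' = k b' \<otimes>\<^bsub>X\<^esub> y'"
    using assms(4) by (rule extension_relationE)
  have x: "x \<in> carrier X" "x' \<in> carrier X" "f y = f x"
    using extension_relation_carrier[OF assms(1)] extension_relation_carrier[OF assms(3)]
      extension_relation_fibre[OF assms(1)] by simp_all
  \<comment> \<open>Since \<open>x\<close> and \<open>y\<close> share a fibre, this \<open>c\<close>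
    applies to the pair \<open>y\<close>, \<open>y'\<close> as well as to \<open>x\<close>,
    \<open>x'\<close>.\<close>
  obtain c where c: "c \<in> carrier K"
    "\<And>v v'. v \<in> carrier X \<Longrightarrow> v' \<in> carrier X \<Longrightarrow> f v = f x \<Longrightarrow>
      (k b \<otimes>\<^bsub>X\<^esub> v) \<otimes>\<^bsub>X\<^esub> (k b' \<otimes>\<^bsub>X\<^esub> v') = k c \<otimes>\<^bsub>X\<^esub> (v \<otimes>\<^bsub>X\<^esub> v')"
    using product_conjugation[OF f_closed[OF x(1)] b(1) b'(1)] by metis
  \<comment> \<open>At \<open>y\<close>, \<open>y'\<close> it shows that \<open>c\<close> is the
    coefficient from \<open>y \<otimes> y'\<close> to \<open>z \<otimes> z'\<close>, so the
    connector multiplies \<open>x \<otimes> x'\<close> by \<open>k c\<close>; at \<open>x\<close>,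
    \<open>x'\<close> it then splits the result into the two factors.\<close>
  have "extension_connector (x \<otimes>\<^bsub>X\<^esub> x', y \<otimes>\<^bsub>X\<^esub> y', z \<otimes>\<^bsub>X\<^esub> z') = k c \<otimes>\<^bsub>X\<^esub> (x \<otimes>\<^bsub>X\<^esub> x')"
    using b b' c(1) c(2)[OF b(2) b'(2) x(3)] by (intro extension_connector_eq) simp_all
  then show ?thesis
    using c(2)[OF x(1,2) refl] extension_connector_eq[OF b] extension_connector_eq[OF b'] by simp
qed

lemma connector_extension_connector: "connector X R R extension_connector"
  unfolding connector_def
proof (intro conjI allI impI)
  let ?P = "relation_pullback X R R"
  have "extension_connector \<in> hom ?P X"
  proof (rule homI)
    fix v assume "v \<in> carrier ?P"
    then show "extension_connector v \<in> carrier X"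
      by (auto simp: relation_pullback_def extension_connector_closed)
  next
    fix v w assume "v \<in> carrier ?P" "w \<in> carrier ?P"
    then show "extension_connector (v \<otimes>\<^bsub>?P\<^esub> w) = extension_connector v \<otimes>\<^bsub>X\<^esub> extension_connector w"
      by (auto simp: relation_pullback_def DirProd_def extension_connector_mult)
  qed
  moreover have "extension_connector \<one>\<^bsub>?P\<^esub> = \<one>\<^bsub>X\<^esub>"
    using extension_connector_eq[of "\<one>\<^bsub>K\<^esub>" "\<one>\<^bsub>X\<^esub>" "\<one>\<^bsub>X\<^esub>" "\<one>\<^bsub>X\<^esub>"]
    by (simp add: relation_pullback_def DirProd_def)
  ultimately show "extension_connector \<in> monoid_hom ?P X"
    by (simp add: monoid_hom_def)
next
  fix x z assume "(x, z) \<in> R"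
  then show "extension_connector (x, x, z) = z"
    \<comment> \<open>With the first two entries equal, the coefficient that leads from
      \<open>x\<close> to \<open>z\<close> is applied to \<open>x\<close> itself.\<close>
    by (metis extension_relationE extension_connector_eq)
next
  fix x y assume "(x, y) \<in> R"
  then have "x \<in> carrier X" "y \<in> carrier X"
    by (rule extension_relation_carrier)+
  \<comment> \<open>The coefficient from \<open>y\<close> to itself is the unit of \<open>K\<close>,
    which fixes \<open>x\<close>.\<close>
  then show "extension_connector (x, y, y) = x"
    using extension_connector_eq[of "\<one>\<^bsub>K\<^esub>" y y x] by simp
qed

end

theorem proposition5p7:
  fixes K :: "('k, 'c) monoid_scheme"
    and X :: "('x, 'd) monoid_scheme"
    and M :: "('m, 'e) monoid_scheme"
    and k :: "'k \<Rightarrow> 'x" and f :: "'x \<Rightarrow> 'm"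
  assumes "schreier_extension K X M k f"
    and "comm_monoid_cancel K"
  shows "centralises X (extension_relation K X k) (extension_relation K X k)"
proof -
  interpret comm_schreier_extension K X M k f
    using assms by (rule comm_schreier_extension.intro)
  show ?thesis
    unfolding centralises_def
    using reflexive_extension_relation schreier_reflexive_extension_relation
      connector_extension_connector by blast
qed

end
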